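(* Let $\mathbf d=(d_1,\dots,d_n)$ be a degree sequence of length $n$, let $m=\big(\sum_{i=1}^n d_i\big)/2$ and $m^*=\sum_{i=1}^n\min(d_i,n-d_i)$. Then for all pairs of realizations $G_1,G_2$ of $\mathbf d$, $$\mathbf{dist}_u(G_1,G_2)\le H'(G_1,G_2)\cdot\left(1-\frac{4}{3n}\right)\le m^*\left(\frac12-\frac{2}{3n}\right)\le m\left(1-\frac{4}{3n}\right).$$
   Context: All graphs are finite, simple and undirected, with labeled vertices $v_1,\dots,v_n$. A graph $G$ realizes a sequence $\mathbf d=(d_1,\dots,d_n)$ of positive integers if $d(v_i)=d_i$ for all $i$; a degree sequence is a sequence having a realization. Swap: if $a,b,c,d$ are four different vertices of $G$ with $(a,c),(b,d)\in E(G)$ and $(b,c),(a,d)\notin E(G)$, then a swap replaces $G$ by the graph $G'$ on the same vertex set with $E(G')=E(G)\setminus\{(a,c),(b,d)\}\cup\{(b,c),(a,d)\}$; $G'$ has the same degree sequence. $\mathbf{dist}_u(G_1,G_2)$ is the length (number of swaps) of a shortest sequence of swaps transforming $G_1$ into $G_2$. $H'(G_1,G_2)=|E(G_1)\,\Delta\, E(G_2)|/2$, where $\Delta$ is the symmetric difference. *)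

theory Defs
  imports Complex_Main "HOL-Library.Extended_Real"
begin

text \<open>A simple undirected graph on a given vertex set is identified with its edge set, a set of
  two-element sets of vertices. The labeled vertices \<open>v\<^sub>1, \<dots>, v\<^sub>n\<close> are represented by
  \<open>0, \<dots>, n - 1\<close>, and a sequence \<open>(d\<^sub>1, \<dots>, d\<^sub>n)\<close> by a list.\<close>

definition simple_graph :: "'a set \<Rightarrow> 'a set set \<Rightarrow> bool" where
  "simple_graph V E \<longleftrightarrow> finite V \<and> (\<forall>e\<in>E. e \<subseteq> V \<and> card e = 2)"

definition degree :: "'a set set \<Rightarrow> 'a \<Rightarrow> nat" where
  "degree E v = card {e \<in> E. v \<in> e}"

definition realizes :: "nat set set \<Rightarrow> nat list \<Rightarrow> bool" where
  "realizes E ds \<longleftrightarrow>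
     simple_graph {..<length ds} E \<and> (\<forall>i<length ds. degree E i = ds ! i)"

definition degree_sequence :: "nat list \<Rightarrow> bool" where
  "degree_sequence ds \<longleftrightarrow> (\<forall>x\<in>set ds. 0 < x) \<and> (\<exists>E. realizes E ds)"

text \<open>On simple graphs \<open>a, b, c, d\<close> need not be required to be vertices, since they are
  endpoints of edges.\<close>

definition swap :: "'a set set \<Rightarrow> 'a set set \<Rightarrow> bool" where
  "swap E E' \<longleftrightarrow> (\<exists>a b c d. distinct [a, b, c, d] \<and>
     {a, c} \<in> E \<and> {b, d} \<in> E \<and> {b, c} \<notin> E \<and> {a, d} \<notin> E \<and>
     E' = (E - {{a, c}, {b, d}}) \<union> {{b, c}, {a, d}})"

text \<open>The value is \<open>\<infinity>\<close> if no sequence of swaps leads from \<open>E1\<close> to \<open>E2\<close>, so a finite upper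
  bound on the distance includes the existence of such a sequence.\<close>

definition swap_dist :: "'a set set \<Rightarrow> 'a set set \<Rightarrow> enat" where
  "swap_dist E1 E2 = Inf {enat k | k. (swap ^^ k) E1 E2}"

definition half_sym_diff :: "'a set set \<Rightarrow> 'a set set \<Rightarrow> real" where
  "half_sym_diff E1 E2 = real (card (sym_diff E1 E2)) / 2"

end

theory Submission
  imports Defs "HOL-Library.Sublist"
begin

text \<open>Give the edges of the symmetric difference the sign \<open>1\<close> or \<open>-1\<close> according to whether they lie
  in \<open>G\<^sub>1\<close> or \<open>G\<^sub>2\<close>; then all signed degrees vanish. A minimal nonempty set with vanishing signed
  degrees is a closed alternating trail. It visits no vertex three times and its repetitions do not
  cross, since otherwise some of its segments would form a smaller balanced set. Hence it has fewer
  than \<open>3n/2\<close> edges, and the symmetric difference splits into \<open>c \<ge> 4H'/(3n)\<close> balanced sets. On the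
  other hand, whenever it splits into \<open>c\<close> nonempty balanced sets, \<open>H' - c\<close> swaps suffice: take a
  largest packing with a smallest part, and replace three consecutive edges of that part by the
  edge joining their ends. This is one swap, in \<open>G\<^sub>1\<close> or in \<open>G\<^sub>2\<close>; if the joining edge is already in
  the symmetric difference, either the four edges are removed by a single swap or the packing was
  not extremal.\<close>

section \<open>Signed degrees and balanced edge sets\<close>

text \<open>The sign function is a parameter defined on all sets, because it changes when a swap
  changes the first graph and must also cover edges that enter the symmetric difference
  later.\<close>

definition signed_degree :: "('a set \<Rightarrow> int) \<Rightarrow> 'a set set \<Rightarrow> 'a \<Rightarrow> int" where
  "signed_degree s B v = (\<Sum>e\<in>B. of_bool (v \<in> e) * s e)"

definition balanced :: "('a set \<Rightarrow> int) \<Rightarrow> 'a set set \<Rightarrow> bool" where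
  "balanced s B \<longleftrightarrow> (\<forall>v. signed_degree s B v = 0)"

definition minimal_balanced :: "('a set \<Rightarrow> int) \<Rightarrow> 'a set set \<Rightarrow> bool" where
  "minimal_balanced s C \<longleftrightarrow>
     C \<noteq> {} \<and> balanced s C \<and> (\<forall>B\<subseteq>C. B \<noteq> {} \<longrightarrow> balanced s B \<longrightarrow> B = C)"

lemma signed_degree_Un:
  assumes "finite A" "finite B" "A \<inter> B = {}"
  shows "signed_degree s (A \<union> B) v = signed_degree s A v + signed_degree s B v"
  unfolding signed_degree_def using assms by (rule sum.union_disjoint)

lemma signed_degree_Diff:
  assumes "finite A" "B \<subseteq> A"
  shows "signed_degree s (A - B) v = signed_degree s A v - signed_degree s B v"
  unfolding signed_degree_def using assms by (rule sum_diff)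

lemma signed_degree_cong:
  assumes "\<And>e. e \<in> B \<Longrightarrow> s e = s' e"
  shows "signed_degree s B v = signed_degree s' B v"
  using assms by (simp add: signed_degree_def)

lemma balanced_Un:
  assumes "finite A" "finite B" "A \<inter> B = {}" "balanced s A" "balanced s B"
  shows "balanced s (A \<union> B)"
  using assms by (simp add: balanced_def signed_degree_Un)

lemma balanced_Diff:
  assumes "finite A" "B \<subseteq> A" "balanced s A" "balanced s B"
  shows "balanced s (A - B)"
  using assms by (simp add: balanced_def signed_degree_Diff)

lemma balanced_cong:
  assumes "\<And>e. e \<in> B \<Longrightarrow> s e = s' e"
  shows "balanced s B \<longleftrightarrow> balanced s' B"
  unfolding balanced_def using signed_degree_cong[of B s s'] assms by metis

lemma exists_minimal_balanced_subset:
  assumes "finite D" "D \<noteq> {}" "balanced s D"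
  obtains C where "C \<subseteq> D" "minimal_balanced s C"
proof -
  let ?P = "\<lambda>C. C \<subseteq> D \<and> C \<noteq> {} \<and> balanced s C"
  have "?P D" using assms by simp
  then obtain C where C: "?P C" and least: "\<And>B. ?P B \<Longrightarrow> card C \<le> card B"
    using ex_has_least_nat[of ?P D card] by blast
  have "B = C" if "B \<subseteq> C" "B \<noteq> {}" "balanced s B" for B
    using card_seteq[OF _ that(1)] least[of B] that C assms(1) finite_subset by blast
  with C that show thesis by (auto simp: minimal_balanced_def)
qed

section \<open>Alternating trails\<close>

text \<open>Only \<open>x 0, ..., x L\<close> matter. The sign \<open>(-1) ^ i\<close> makes the
  first edge positive, so the parity of an index tells the sign of the edge that leaves it.\<close>

definition alternating_trail ::
    "('a set \<Rightarrow> int) \<Rightarrow> 'a set set \<Rightarrow> (nat \<Rightarrow> 'a) \<Rightarrow> nat \<Rightarrow> bool" where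
  "alternating_trail s B x L \<longleftrightarrow>
     inj_on (\<lambda>i. {x i, x (Suc i)}) {..<L} \<and>
     (\<forall>i<L. {x i, x (Suc i)} \<in> B \<and> s {x i, x (Suc i)} = (-1) ^ i)"

lemma card_two_doubleton_iff: "card {a, b} = 2 \<longleftrightarrow> a \<noteq> b"
  by (cases "a = b") auto

text \<open>At an inner visit two edges of opposite signs meet and cancel, so the sum telescopes to
  the two ends. Ends that coincide at indices of equal parity give a balanced segment.\<close>

lemma signed_degree_trail_segment:
  assumes "alternating_trail s B x L" "\<And>e. e \<in> B \<Longrightarrow> card e = 2" "p \<le> q" "q \<le> L"
  shows "signed_degree s ((\<lambda>i. {x i, x (Suc i)}) ` {p..<q}) v =
    (-1) ^ p * of_bool (v = x p) - (-1) ^ q * of_bool (v = x q)"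
proof -
  let ?e = "\<lambda>i. {x i, x (Suc i)}"
  let ?f = "\<lambda>i. (-1) ^ i * of_bool (v = x i) :: int"
  have inj: "inj_on ?e {p..<q}"
    using assms(1,4) unfolding alternating_trail_def by (elim conjE inj_on_subset) auto
  have "signed_degree s (?e ` {p..<q}) v = (\<Sum>i=p..<q. of_bool (v \<in> ?e i) * s (?e i))"
    unfolding signed_degree_def by (rule sum.reindex_cong[OF inj]) auto
  also have "\<dots> = (\<Sum>i=p..<q. - (?f (Suc i) - ?f i))"
  proof (rule sum.cong)
    fix i assume "i \<in> {p..<q}"
    then have "?e i \<in> B" and s: "s (?e i) = (-1) ^ i"
      using assms(1,4) by (auto simp: alternating_trail_def)
    \<comment> \<open>As the ends differ, the indicator of membership in the edge is the sum of the
      indicators of its two ends, which yields the telescoping difference.\<close>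
    then have "x i \<noteq> x (Suc i)" using assms(2) card_two_doubleton_iff by metis
    with s show "of_bool (v \<in> ?e i) * s (?e i) = - (?f (Suc i) - ?f i)" by auto
  qed simp
  also have "\<dots> = ?f p - ?f q"
    unfolding sum_negf sum_Suc_diff'[OF assms(3), of ?f] by simp
  finally show ?thesis .
qed

lemma trail_length_le:
  assumes "alternating_trail s B x L" "finite B"
  shows "L \<le> card B"
proof -
  have "card ((\<lambda>i. {x i, x (Suc i)}) ` {..<L}) = L"
    using assms(1) by (simp add: alternating_trail_def card_image)
  moreover have "(\<lambda>i. {x i, x (Suc i)}) ` {..<L} \<subseteq> B"
    using assms(1) by (auto simp: alternating_trail_def)
  ultimately show ?thesis using card_mono[OF assms(2)] by metis
qed

lemma exists_closed_alternating_trail: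
  assumes "finite B" "balanced s B" "\<And>e. e \<in> B \<Longrightarrow> card e = 2"
    and sign: "\<And>e. e \<in> B \<Longrightarrow> s e = 1 \<or> s e = -1"
    and "r \<in> B" "a \<in> r" "s r = 1"
  obtains x L where "alternating_trail s B x L" "x 0 = a" "0 < L" "even L" "x L = a"
proof -
  let ?P = "\<lambda>L. \<exists>x. alternating_trail s B x L \<and> x 0 = a"
  obtain b where "r = {a, b}"
    using assms(3,5,6) by (metis card_2_iff empty_iff insert_commute insert_iff)
  then have P1: "?P 1"
    using assms by (intro exI[of _ "\<lambda>i. if i = 0 then a else b"])
      (simp add: alternating_trail_def inj_on_def)
  define L where "L = Greatest ?P"
  have bound: "\<forall>k. ?P k \<longrightarrow> k \<le> card B" using trail_length_le assms(1) by blast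
  from GreatestI_nat[of ?P, OF P1] bound have "?P L" unfolding L_def by blast
  then obtain x where x: "alternating_trail s B x L" "x 0 = a" by blast
  have "1 \<le> L" unfolding L_def using Greatest_le_nat[of ?P, OF P1] bound by blast
  have maximal: "\<not> ?P (Suc L)"
    using Greatest_le_nat[of ?P "Suc L" "card B"] bound unfolding L_def by fastforce
  have "even L \<and> x L = a"
  proof (rule ccontr)
    assume open_trail: "\<not> (even L \<and> x L = a)"
    let ?T = "(\<lambda>i. {x i, x (Suc i)}) ` {0..<L}"
    have "?T \<subseteq> B" using x by (auto simp: alternating_trail_def)
    then have deg: "signed_degree s (B - ?T) (x L) = (-1) ^ L - of_bool (x L = a)"
      using assms(2) signed_degree_trail_segment[OF x(1) assms(3), of 0 L "x L"] x(2)
      by (simp add: signed_degree_Diff[OF assms(1)] balanced_def)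
    have "\<exists>e. e \<in> B - ?T \<and> x L \<in> e \<and> s e = (-1) ^ L"
    proof (rule ccontr)
      assume "\<not> ?thesis"
      then have no: "s e = - ((-1) ^ L)" if "e \<in> B - ?T" "x L \<in> e" for e
        using that sign[of e] by (cases "even L") auto
      show False
      proof (cases "even L")
        case True
        then have "signed_degree s (B - ?T) (x L) \<le> 0"
          unfolding signed_degree_def using no by (intro sum_nonpos) auto
        with deg True open_trail show False by auto
      next
        case False
        then have "0 \<le> signed_degree s (B - ?T) (x L)"
          unfolding signed_degree_def using no by (intro sum_nonneg) auto
        with deg False show False by (cases "x L = a") auto
      qed
    qed
    then obtain e where e: "e \<in> B - ?T" "x L \<in> e" "s e = (-1) ^ L" by blast
    obtain w where w: "e = {x L, w}"
      using assms(3) e(1,2) by (metis DiffD1 card_2_iff empty_iff insert_commute insert_iff)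
    have "alternating_trail s B (x(Suc L := w)) (Suc L)"
      unfolding alternating_trail_def
    proof
      have eq: "{(x(Suc L := w)) i, (x(Suc L := w)) (Suc i)} = (if i = L then e else {x i, x (Suc i)})"
        if "i < Suc L" for i using that w by auto
      show "inj_on (\<lambda>i. {(x(Suc L := w)) i, (x(Suc L := w)) (Suc i)}) {..<Suc L}"
        using x(1) e(1) unfolding alternating_trail_def
        by (subst inj_on_cong[OF eq]) (auto simp: inj_on_def less_Suc_eq)
      show "\<forall>i<Suc L. {(x(Suc L := w)) i, (x(Suc L := w)) (Suc i)} \<in> B \<and>
          s {(x(Suc L := w)) i, (x(Suc L := w)) (Suc i)} = (-1) ^ i"
        using x(1) e unfolding alternating_trail_def by (simp add: eq less_Suc_eq del: fun_upd_apply)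
    qed
    with maximal x(2) show False by force
  qed
  with x \<open>1 \<le> L\<close> that show thesis by auto
qed

section \<open>Closed trails without crossing repetitions\<close>

text \<open>Lists replace index functions here, because the induction below cuts a closed trail into
  two shorter ones.\<close>

fun walk_edges :: "'a list \<Rightarrow> 'a set list" where
  "walk_edges (u # v # xs) = {u, v} # walk_edges (v # xs)"
| "walk_edges _ = []"

lemma walk_edges_append:
  "walk_edges (xs @ v # ys) = walk_edges (xs @ [v]) @ walk_edges (v # ys)"
  by (induction xs rule: walk_edges.induct) auto

lemma walk_edges_map_upt:
  "walk_edges (map x [m..<Suc (m + k)]) = map (\<lambda>i. {x i, x (Suc i)}) [m..<m + k]"
proof (induction k arbitrary: m)
  case (Suc k)
  have "walk_edges (map x [m..<Suc (m + Suc k)]) =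
      {x m, x (Suc m)} # walk_edges (map x [Suc m..<Suc (Suc m + k)])"
    by (simp add: upt_conv_Cons del: upt_Suc)
  then show ?case using Suc[of "Suc m"] by (simp add: upt_conv_Cons del: upt_Suc)
qed auto

text \<open>One step would be a loop, and two steps would use the same edge twice.\<close>

lemma closed_trail_length_ge_3:
  assumes "distinct (walk_edges (u # xs))" "\<forall>e\<in>set (walk_edges (u # xs)). card e = 2"
    "xs \<noteq> []" "last xs = u"
  shows "3 \<le> length xs"
proof -
  consider "\<exists>v. xs = [v]" | "\<exists>v w. xs = [v, w]" | "3 \<le> length xs"
    using assms(3) by (cases xs rule: walk_edges.cases; force simp: neq_Nil_conv Suc_le_eq)
  then show ?thesis
    using assms by cases (auto simp: insert_commute)
qed

text \<open>Splitting the trail at a repeated vertex gives two closed trails that share only this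
  vertex, and closed trails without repetitions have length at least 3.\<close>

lemma noncrossing_closed_trail_bound:
  assumes "distinct (walk_edges (u # xs))" "\<forall>e\<in>set (walk_edges (u # xs)). card e = 2"
    "xs \<noteq> []" "last xs = u"
    and "\<And>v. \<not> subseq [v, v, v] xs" "\<And>v w. \<not> subseq [v, w, v, w] xs"
  shows "2 * length xs + 3 \<le> 3 * card (set xs)"
  using assms
proof (induction "length xs" arbitrary: u xs rule: less_induct)
  case less
  show ?case
  proof (cases "distinct xs")
    case True
    then show ?thesis
      using closed_trail_length_ge_3[OF less.prems(1-4)] by (simp add: distinct_card)
  next
    case False
    then obtain A B C v where xs: "xs = A @ [v] @ B @ [v] @ C"
      using not_distinct_decomp by blast
    \<comment> \<open>\<open>?X\<close> is the closed trail between the two visits of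
      \<open>v\<close>, and \<open>?Y\<close> is what remains after contracting it to
      \<open>v\<close>.\<close>
    let ?X = "B @ [v]" and ?Y = "A @ v # C"
    have we: "walk_edges (u # xs) =
        walk_edges (u # A @ [v]) @ walk_edges (v # B @ [v]) @ walk_edges (v # C)"
      using walk_edges_append[of "u # A" v "B @ v # C"] walk_edges_append[of "v # B" v C]
      by (simp add: xs)
    have weY: "walk_edges (u # ?Y) = walk_edges (u # A @ [v]) @ walk_edges (v # C)"
      using walk_edges_append[of "u # A" v C] by simp
    have "subseq ([] @ [] @ B @ [v] @ []) xs" "subseq (A @ [v] @ [] @ [] @ C) xs"
      unfolding xs by (intro list_emb_append_mono; simp)+
    then have sub: "subseq ?X xs" "subseq ?Y xs" by simp_all
    have X: "2 * length ?X + 3 \<le> 3 * card (set ?X)"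
    proof (rule less.hyps)
      show "distinct (walk_edges (v # ?X))" "\<forall>e\<in>set (walk_edges (v # ?X)). card e = 2"
        using less.prems(1,2) unfolding we by auto
      show "\<not> subseq [w, w, w] ?X" "\<not> subseq [w, z, w, z] ?X" for w z
        using less.prems(5,6) sub subseq_order.trans by blast+
    qed (auto simp: xs)
    have Y: "2 * length ?Y + 3 \<le> 3 * card (set ?Y)"
    proof (rule less.hyps)
      show "distinct (walk_edges (u # ?Y))" "\<forall>e\<in>set (walk_edges (u # ?Y)). card e = 2"
        using less.prems(1,2) unfolding we weY by auto
      show "\<not> subseq [w, w, w] ?Y" "\<not> subseq [w, z, w, z] ?Y" for w z
        using less.prems(5,6) sub subseq_order.trans by blast+
      show "last ?Y = u" using less.prems(4) by (simp add: xs split: if_splits)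
    qed (auto simp: xs)
    \<comment> \<open>Another common vertex \<open>w\<close>, or a third visit of \<open>v\<close>,
      would give one of the patterns \<open>w v w v\<close>, \<open>v w v w\<close> and
      \<open>v v v\<close>.\<close>
    have "set ?X \<inter> set ?Y = {v}"
    proof -
      have False if w: "w \<in> set B" "w \<in> set A \<or> w = v \<or> w \<in> set C" for w
      proof -
        have B: "subseq [w] B" using w(1) by (simp add: subseq_singleton_left)
        consider "w \<in> set A" | "w = v" | "w \<in> set C" using w(2) by blast
        then show False
        proof cases
          case 1
          then have "subseq ([w] @ [v] @ [w] @ [v] @ []) xs" unfolding xs
            using B by (intro list_emb_append_mono) (auto simp: subseq_singleton_left)
          then show False using less.prems(6) by simp
        next
          case 2
          then have "subseq ([] @ [v] @ [w] @ [v] @ []) xs" unfolding xs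
            using B by (intro list_emb_append_mono) (auto simp: subseq_singleton_left)
          then show False using less.prems(5) 2 by simp
        next
          case 3
          then have "subseq ([] @ [v] @ [w] @ [v] @ [w]) xs" unfolding xs
            using B by (intro list_emb_append_mono) (auto simp: subseq_singleton_left)
          then show False using less.prems(6) by simp
        qed
      qed
      moreover have "v \<notin> set A"
      proof
        assume "v \<in> set A"
        then have "subseq ([v] @ [v] @ [] @ [v] @ []) xs" unfolding xs
          by (intro list_emb_append_mono) (auto simp: subseq_singleton_left)
        then show False using less.prems(5) by simp
      qed
      ultimately show ?thesis by auto
    qed
    then have "card (set ?X \<inter> set ?Y) = 1" by (simp only: card.empty card.insert finite.emptyI empty_iff simp_thms One_nat_def if_False)
    moreover have "set xs = set ?X \<union> set ?Y" by (auto simp: xs)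
    \<comment> \<open>The lengths add up while \<open>v\<close> is counted twice; of the two surplus
      terms \<open>3\<close>, one pays for \<open>v\<close> and the other remains.\<close>
    ultimately have "card (set xs) + 1 = card (set ?X) + card (set ?Y)"
      using card_Un_Int[of "set ?X" "set ?Y"] by (metis List.finite_set add.commute)
    with X Y show ?thesis by (simp add: xs)
  qed
qed

text \<open>Turns a pattern in the list of visits into increasing indices, one entry at a
  time.\<close>

lemma subseq_Cons_map_uptD:
  assumes "subseq (u # ys) (map x [m..<n])"
  obtains i where "m \<le> i" "i < n" "x i = u" "subseq ys (map x [Suc i..<n])"
proof -
  have "\<exists>i. m \<le> i \<and> i < n \<and> x i = u \<and> subseq ys (map x [Suc i..<n])"
    using assms
  proof (induction "n - m" arbitrary: m)
    case (Suc k)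
    then have "m < n" by simp
    then have upt: "[m..<n] = m # [Suc m..<n]" by (rule upt_conv_Cons)
    show ?case
    proof (cases "u = x m")
      case True
      with Suc.prems have "subseq ys (map x [Suc m..<n])" by (simp add: upt)
      with True \<open>m < n\<close> show ?thesis by auto
    next
      case False
      with Suc.prems have "subseq (u # ys) (map x [Suc m..<n])" by (simp add: upt)
      from Suc.hyps(1)[OF _ this] Suc.hyps(2) show ?thesis
        by (metis Suc_leD diff_Suc_1 diff_Suc_eq_diff_pred minus_nat.diff_Suc)
    qed
  qed auto
  with that show thesis by blast
qed

section \<open>Minimal balanced sets\<close>

text \<open>The telescoped ends cancel, so the segment is balanced and minimality lets it exhaust
  \<open>C\<close>.\<close>

lemma minimal_balanced_trail_segment:
  assumes "minimal_balanced s C" "\<And>e. e \<in> C \<Longrightarrow> card e = 2"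
    "alternating_trail s C x L" "i < j" "j \<le> L" "x i = x j" "even i = even j"
  shows "(\<lambda>i. {x i, x (Suc i)}) ` {i..<j} = C"
proof -
  let ?S = "(\<lambda>i. {x i, x (Suc i)}) ` {i..<j}"
  have "?S \<subseteq> C" "?S \<noteq> {}" using assms by (auto simp: alternating_trail_def)
  moreover have "(-1) ^ i = ((-1) ^ j :: int)" using assms(7) by (cases "even i") auto
  then have "balanced s ?S"
    unfolding balanced_def
    using signed_degree_trail_segment[OF assms(3,2), of i j] assms(4-6) by simp
  ultimately show ?thesis using assms(1) by (simp add: minimal_balanced_def)
qed

text \<open>The segment is all of \<open>C\<close>, hence contains the first edge of the trail,
  which occurs only at index \<open>0\<close>. Thus repeated visits at positive indices have
  opposite parities.\<close>

lemma minimal_balanced_parity: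
  assumes "minimal_balanced s C" "\<And>e. e \<in> C \<Longrightarrow> card e = 2"
    "alternating_trail s C x L" "i < j" "j \<le> L" "x i = x j" "even i = even j"
  shows "i = 0"
proof (rule ccontr)
  assume "i \<noteq> 0"
  let ?e = "\<lambda>i. {x i, x (Suc i)}"
  have inj: "inj_on ?e {..<L}" using assms(3) by (simp add: alternating_trail_def)
  have "?e 0 \<in> C" using assms(3-5) by (auto simp: alternating_trail_def)
  then obtain k where "k \<in> {i..<j}" "?e k = ?e 0"
    using minimal_balanced_trail_segment[OF assms] by (metis (no_types, lifting) imageE)
  then have "k = 0" using inj_onD[OF inj, of k 0] assms(4,5) by auto
  with \<open>k \<in> {i..<j}\<close> \<open>i \<noteq> 0\<close> show False by simp
qed

text \<open>By parity, the two segments that lead from one of the vertices to the other, starting with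
  edges of opposite signs, together form a proper balanced subset.\<close>

lemma minimal_balanced_noncrossing:
  assumes "minimal_balanced s C" "finite C" "\<And>e. e \<in> C \<Longrightarrow> card e = 2"
    "alternating_trail s C x L"
    and "0 < i" "i < k" "k < j" "j < l" "l \<le> L" "x i = x j" "x k = x l"
  shows False
proof -
  let ?e = "\<lambda>i. {x i, x (Suc i)}"
  have inj: "inj_on ?e {..<L}" using assms(4) by (simp add: alternating_trail_def)
  have "even i \<noteq> even j" "even k \<noteq> even l"
    using minimal_balanced_parity[OF assms(1,3,4), of i j]
      minimal_balanced_parity[OF assms(1,3,4), of k l] assms(5-11) by auto
  then have par: "(-1) ^ j = - ((-1) ^ i :: int)" "(-1) ^ l = - ((-1) ^ k :: int)"
    by (cases "even i"; cases "even k"; simp)+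
  let ?S = "?e ` {i..<k}" and ?T = "?e ` {j..<l}"
  have "?S \<inter> ?T = ?e ` ({i..<k} \<inter> {j..<l})"
    using assms(5-9) by (intro inj_on_image_Int[OF inj, symmetric]) auto
  then have disj: "?S \<inter> ?T = {}" using assms(7) by auto
  have "balanced s (?S \<union> ?T)"
    unfolding balanced_def
    using signed_degree_trail_segment[OF assms(4,3), of i k]
      signed_degree_trail_segment[OF assms(4,3), of j l] assms(6-11) par
    by (simp add: signed_degree_Un[OF _ _ disj])
  moreover have "?S \<union> ?T \<subseteq> C" "?S \<union> ?T \<noteq> {}"
    using assms(4,6,7,8,9) by (auto simp: alternating_trail_def)
  ultimately have "?S \<union> ?T = C" using assms(1) by (simp add: minimal_balanced_def)
  \<comment> \<open>The edge leaving index \<open>k\<close> lies in \<open>C\<close> but in neither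
    segment, because \<open>k < j\<close>.\<close>
  moreover have "?e k \<in> C" using assms(4,7-9) by (auto simp: alternating_trail_def)
  ultimately have "?e k \<in> ?e ` ({i..<k} \<union> {j..<l})" by (simp add: image_Un)
  then obtain q where "q \<in> {i..<k} \<union> {j..<l}" "?e k = ?e q" by blast
  moreover from this have "k = q" using inj_onD[OF inj, of k q] assms(7-9) by auto
  ultimately show False using assms(7) by auto
qed

lemma balanced_positive_edge:
  assumes "balanced s C" "finite C" "\<And>e. e \<in> C \<Longrightarrow> s e = 1 \<or> s e = -1" "e \<in> C" "a \<in> e"
  obtains r where "r \<in> C" "a \<in> r" "s r = 1"
proof -
  have "\<exists>r\<in>C. a \<in> r \<and> s r = 1"
  proof (rule ccontr)
    assume no: "\<not> ?thesis"
    have "(\<Sum>e\<in>C. of_bool (a \<in> e) * s e) < (\<Sum>e\<in>C. 0)"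
    proof (rule sum_strict_mono_ex1[OF assms(2)])
      show "\<forall>e\<in>C. of_bool (a \<in> e) * s e \<le> 0" using assms(3) no by force
      have "s e = -1" using assms(3)[of e] assms(4,5) no by blast
      then show "\<exists>e\<in>C. of_bool (a \<in> e) * s e < 0"
        using assms(4,5) by (intro bexI[of _ e]) auto
    qed
    with assms(1) show False by (simp add: balanced_def signed_degree_def)
  qed
  with that show thesis by blast
qed

lemma finite_simple_graph:
  assumes "simple_graph V E"
  shows "finite E"
proof (rule finite_subset)
  show "E \<subseteq> Pow V" using assms by (auto simp: simple_graph_def)
qed (use assms in \<open>simp add: simple_graph_def\<close>)

text \<open>Handshake lemma, by double counting the incidences.\<close>

lemma sum_degree_eq:
  assumes "simple_graph V E"
  shows "(\<Sum>v\<in>V. degree E v) = 2 * card E"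
proof -
  have "(\<Sum>v\<in>V. degree E v) = (\<Sum>e\<in>E. card {v \<in> V. v \<in> e})"
    using sum.swap_restrict[of V E "\<lambda>_ _. 1::nat" "\<lambda>v e. v \<in> e"] assms finite_simple_graph[OF assms]
    by (simp add: degree_def simple_graph_def)
  also have "\<dots> = (\<Sum>e\<in>E. 2)"
  proof (rule sum.cong)
    fix e assume "e \<in> E"
    then have "{v \<in> V. v \<in> e} = e" "card e = 2" using assms by (auto simp: simple_graph_def)
    then show "card {v \<in> V. v \<in> e} = 2" by simp
  qed simp
  finally show ?thesis by simp
qed

text \<open>A single closed alternating trail exhausts \<open>C\<close>, and minimality excludes
  triple visits and crossing repetitions in it.\<close>

lemma minimal_balanced_card_bound:
  assumes "minimal_balanced s C" "finite C" "\<And>e. e \<in> C \<Longrightarrow> card e = 2"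
    "\<And>e. e \<in> C \<Longrightarrow> s e = 1 \<or> s e = -1"
  shows "2 * card C + 3 \<le> 3 * card (\<Union>C)"
proof -
    have bal: "balanced s C" and "C \<noteq> {}" using assms(1) by (simp_all add: minimal_balanced_def)
  then obtain e v where e: "e \<in> C" "v \<in> e"
    using assms(3) by (metis card.empty equals0I zero_neq_numeral)
  obtain r where "r \<in> C" "v \<in> r" "s r = 1"
    using balanced_positive_edge[OF bal assms(2,4) e] by blast
  then obtain x L where trail: "alternating_trail s C x L" and "x 0 = v"
      and closed: "x L = v" "0 < L" "even L"
    using exists_closed_alternating_trail[OF assms(2) bal assms(3,4)] by metis
  note closed = closed[folded \<open>x 0 = v\<close>]
  let ?e = "\<lambda>i. {x i, x (Suc i)}"
  have inj: "inj_on ?e {0..<L}" using trail by (simp add: alternating_trail_def lessThan_atLeast0)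
  have C: "?e ` {0..<L} = C"
    using minimal_balanced_trail_segment[OF assms(1,3) trail, of 0 L] closed by simp
  then have card: "card C = L" using card_image[OF inj] by simp
  \<comment> \<open>Index \<open>0\<close> is left out, since \<open>x 0 = x L\<close> would be
    listed twice and the parity argument needs positive indices.\<close>
  let ?xs = "map x [Suc 0..<Suc L]"
  have cons: "x 0 # ?xs = map x [0..<Suc L]" by (simp add: upt_conv_Cons del: upt_Suc)
  have we: "walk_edges (x 0 # ?xs) = map ?e [0..<L]"
    unfolding cons using walk_edges_map_upt[of x 0 L] by simp
  have "2 * length ?xs + 3 \<le> 3 * card (set ?xs)"
  proof (rule noncrossing_closed_trail_bound)
    show "distinct (walk_edges (x 0 # ?xs))" unfolding we using inj by (simp add: distinct_map)
    show "\<forall>e\<in>set (walk_edges (x 0 # ?xs)). card e = 2"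
      unfolding we using C assms(3) by auto
    show "?xs \<noteq> []" "last ?xs = x 0" using closed by (auto simp: last_map)
    show "\<not> subseq [v, v, v] ?xs" for v
    proof
      assume "subseq [v, v, v] ?xs"
      then obtain i where i: "Suc 0 \<le> i" "i < Suc L" "x i = v"
        "subseq [v, v] (map x [Suc i..<Suc L])" by (rule subseq_Cons_map_uptD)
      from i(4) obtain j where j: "Suc i \<le> j" "j < Suc L" "x j = v"
        "subseq [v] (map x [Suc j..<Suc L])" by (rule subseq_Cons_map_uptD)
      from j(4) obtain k where k: "Suc j \<le> k" "k < Suc L" "x k = v" by (rule subseq_Cons_map_uptD)
      have P: False if "0 < p" "p < q" "q \<le> L" "x p = x q" "even p = even q" for p q
        using minimal_balanced_parity[OF assms(1,3) trail that(2-5)] that(1) by simp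
      \<comment> \<open>Two of the three indices have equal parity.\<close>
      show False using P[of i j] P[of j k] P[of i k] i j k by (auto simp: Suc_le_eq less_Suc_eq_le)
    qed
    show "\<not> subseq [v, w, v, w] ?xs" for v w
    proof
      assume "subseq [v, w, v, w] ?xs"
      then obtain i where i: "Suc 0 \<le> i" "i < Suc L" "x i = v"
        "subseq [w, v, w] (map x [Suc i..<Suc L])" by (rule subseq_Cons_map_uptD)
      from i(4) obtain k where k: "Suc i \<le> k" "k < Suc L" "x k = w"
        "subseq [v, w] (map x [Suc k..<Suc L])" by (rule subseq_Cons_map_uptD)
      from k(4) obtain j where j: "Suc k \<le> j" "j < Suc L" "x j = v"
        "subseq [w] (map x [Suc j..<Suc L])" by (rule subseq_Cons_map_uptD)
      from j(4) obtain l where l: "Suc j \<le> l" "l < Suc L" "x l = w" by (rule subseq_Cons_map_uptD)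
      show False
        using minimal_balanced_noncrossing[OF assms(1-3) trail, of i k j l] i j k l by simp
    qed
  qed
  moreover have "set ?xs = \<Union>C"
  proof -
    have "\<Union>C = x ` ({0..<L} \<union> Suc ` {0..<L})"
      unfolding C[symmetric] image_Un image_image by blast
    also have "{0..<L} \<union> Suc ` {0..<L} = insert 0 {Suc 0..<Suc L}"
      using closed by (auto simp: image_Suc_atLeastLessThan)
    also have "x ` \<dots> = x ` {Suc 0..<Suc L}"
      using closed by (auto simp: image_iff intro!: bexI[of _ L])
    finally show ?thesis by (simp del: upt_Suc)
  qed
  ultimately show ?thesis using card by (simp del: upt_Suc)
qed

text \<open>The size bound makes the average degree in \<open>C\<close> less than \<open>3\<close>,
  so some vertex meets at most two edges of \<open>C\<close>; by balance only one of them is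
  positive.\<close>

lemma exists_unique_positive_edge:
  assumes "minimal_balanced s C" "finite C" "\<And>e. e \<in> C \<Longrightarrow> card e = 2"
    and sign: "\<And>e. e \<in> C \<Longrightarrow> s e = 1 \<or> s e = -1"
  obtains a r where "r \<in> C" "a \<in> r" "s r = 1"
    "\<And>e. e \<in> C \<Longrightarrow> a \<in> e \<Longrightarrow> s e = 1 \<Longrightarrow> e = r"
proof -
  have bal: "balanced s C" using assms(1) by (simp add: minimal_balanced_def)
  have "finite (\<Union>C)" using assms(2,3) by (metis card.infinite finite_Union zero_neq_numeral)
  then have "simple_graph (\<Union>C) C" using assms(3) by (auto simp: simple_graph_def)
  then have degs: "(\<Sum>a\<in>\<Union>C. degree C a) = 2 * card C" by (rule sum_degree_eq)
  have "\<exists>a\<in>\<Union>C. degree C a < 3"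
  proof (rule ccontr)
    assume "\<not> ?thesis"
    then have "(\<Sum>a\<in>\<Union>C. 3) \<le> (\<Sum>a\<in>\<Union>C. degree C a)" by (intro sum_mono) (auto simp: not_less)
    with degs minimal_balanced_card_bound[OF assms] show False by simp
  qed
  then obtain a where a: "a \<in> \<Union>C" "card {e \<in> C. a \<in> e} < 3" unfolding degree_def by blast
  then obtain r where r: "r \<in> C" "a \<in> r" "s r = 1"
    using balanced_positive_edge[OF bal assms(2) sign] by blast
  have "e = r" if e: "e \<in> C" "a \<in> e" "s e = 1" for e
  proof (rule ccontr)
    assume "e \<noteq> r"
    then have "card {e, r} = 2" by simp
    then have "{e, r} = {e \<in> C. a \<in> e}"
      using e r a(2) assms(2) by (intro card_seteq) auto
    then have "signed_degree s C a = (\<Sum>e\<in>{e, r}. of_bool (a \<in> e) * s e)"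
      unfolding signed_degree_def using assms(2) by (intro sum.mono_neutral_right) auto
    with \<open>e \<noteq> r\<close> e r bal show False by (simp add: balanced_def)
  qed
  with r that show thesis by blast
qed

section \<open>Packings by balanced sets\<close>

text \<open>The parts cover \<open>A\<close> exactly and only their number is recorded;
  \<open>packing_part\<close> recovers them.\<close>

inductive packing :: "('a set \<Rightarrow> int) \<Rightarrow> 'a set set \<Rightarrow> nat \<Rightarrow> bool" for s where
  empty: "packing s {} 0"
| Un: "packing s A c \<Longrightarrow> balanced s B \<Longrightarrow> B \<noteq> {} \<Longrightarrow> A \<inter> B = {} \<Longrightarrow> packing s (A \<union> B) (Suc c)"

lemma packing_le_card:
  assumes "packing s A c" "finite A"
  shows "c \<le> card A"
  using assms
proof induction
  case (Un A c B)
  then have "0 < card B" by (simp add: card_gt_0_iff)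
  with Un show ?case by (simp add: card_Un_disjoint)
qed simp

lemma packing_cong:
  assumes "packing s A c" "\<And>e. e \<in> A \<Longrightarrow> s e = s' e"
  shows "packing s' A c"
  using assms
proof induction
  case (Un A c B)
  have "balanced s' B" using Un.hyps(2) Un.prems balanced_cong[of B s s'] by auto
  with Un show ?case by (intro packing.Un) auto
qed (rule packing.empty)

lemma packing_insert_part:
  assumes "packing s (D - B) c" "B \<subseteq> D" "balanced s B" "B \<noteq> {}"
  shows "packing s D (Suc c)"
proof -
  have "packing s ((D - B) \<union> B) (Suc c)" using assms by (intro packing.Un) auto
  then show ?thesis using assms(2) by (simp add: Un_absorb2)
qed

text \<open>The last rule application shows only the part added last; by induction the part that
  contains a given edge can take this place.\<close>

lemma packing_part:
  assumes "packing s A c" "f \<in> A"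
  obtains B c' where "f \<in> B" "B \<subseteq> A" "balanced s B" "packing s (A - B) c'" "c = Suc c'"
proof -
  have "\<exists>B c'. f \<in> B \<and> B \<subseteq> A \<and> balanced s B \<and> packing s (A - B) c' \<and> c = Suc c'"
    using assms
  proof induction
    case (Un A c B)
    show ?case
    proof (cases "f \<in> B")
      case True
      have "(A \<union> B) - B = A" using Un.hyps(4) by blast
      with True Un.hyps show ?thesis by (intro exI[of _ B] exI[of _ c]) auto
    next
      case False
      with Un.prems Un.IH obtain B' c' where B':
        "f \<in> B'" "B' \<subseteq> A" "balanced s B'" "packing s (A - B') c'" "c = Suc c'" by blast
      have "packing s ((A - B') \<union> B) (Suc c')"
        using B' Un.hyps by (intro packing.Un) auto
      moreover have "(A - B') \<union> B = (A \<union> B) - B'" using B' Un.hyps by blast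
      ultimately show ?thesis using B' by (intro exI[of _ B'] exI[of _ c]) auto
    qed
  qed simp
  with that show thesis by blast
qed

text \<open>A largest packing with a smallest part \<open>C\<close>, and a shortcut \<open>{a, d}\<close> of the closed trail
  \<open>a, b, c, d, \<dots>\<close> that covers \<open>C\<close>, where \<open>{a, b}\<close> is the only positive edge of \<open>C\<close> at \<open>a\<close>.\<close>

lemma packing_reduction:
  assumes "finite D" "D \<noteq> {}" and two: "\<And>e. e \<in> D \<Longrightarrow> card e = 2"
    and sign: "\<And>e. e \<in> D \<Longrightarrow> s e = 1 \<or> s e = -1"
    and "packing s D m"
  obtains a b c d N where "m \<le> N" "distinct [a, b, c, d]"
    "{a, b} \<in> D" "{b, c} \<in> D" "{c, d} \<in> D"
    "s {a, b} = 1" "s {b, c} = -1" "s {c, d} = 1"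
    "({a, d} \<in> D \<and> s {a, d} = -1 \<and>
        (\<exists>N'. N = Suc N' \<and> packing s (D - {{a, b}, {b, c}, {c, d}, {a, d}}) N'))
     \<or> ({a, d} \<notin> D \<and> (\<forall>s'. (\<forall>e\<in>D. s' e = s e) \<longrightarrow> s' {a, d} = 1 \<longrightarrow>
        packing s' (insert {a, d} (D - {{a, b}, {b, c}, {c, d}})) N))"
proof -
  define N where "N = Greatest (packing s D)"
  have bound: "\<forall>k. packing s D k \<longrightarrow> k \<le> card D" using packing_le_card assms(1) by blast
  have N: "packing s D N"
    unfolding N_def using GreatestI_nat[of "packing s D" m] assms(5) bound by blast
  have maximal: "k \<le> N" if "packing s D k" for k
    unfolding N_def using Greatest_le_nat[of "packing s D" k] that bound by blast
  obtain f0 where "f0 \<in> D" using assms(2) by blast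
  with N obtain B0 N' where B0: "f0 \<in> B0" "B0 \<subseteq> D" "balanced s B0" "packing s (D - B0) N'"
    and Suc: "N = Suc N'" by (rule packing_part)
  \<comment> \<open>\<open>C\<close> will be a smallest set that occurs as a part of a packing with
    \<open>N\<close> parts.\<close>
  let ?P = "\<lambda>C. C \<noteq> {} \<and> C \<subseteq> D \<and> balanced s C \<and> packing s (D - C) N'"
  have "?P B0" using B0 by blast
  then obtain C where C: "C \<noteq> {}" "C \<subseteq> D" "balanced s C" "packing s (D - C) N'"
    and least: "\<And>B. ?P B \<Longrightarrow> card C \<le> card B"
    using ex_has_least_nat[of ?P B0 card] by blast
  have finC: "finite C" using C(2) assms(1) finite_subset by blast
  \<comment> \<open>A proper balanced subset and its complement in \<open>C\<close> would together
    give \<open>N + 1\<close> parts.\<close>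
  have "B = C" if B: "B \<subseteq> C" "B \<noteq> {}" "balanced s B" for B
  proof (rule ccontr)
    assume "B \<noteq> C"
    have "(D - B) - (C - B) = D - C" using B(1) by blast
    then have "packing s ((D - B) - (C - B)) N'" using C(4) by simp
    then have "packing s (D - B) (Suc N')"
    proof (rule packing_insert_part)
      show "C - B \<subseteq> D - B" "C - B \<noteq> {}" using B(1) C(2) \<open>B \<noteq> C\<close> by blast+
      show "balanced s (C - B)" using balanced_Diff[OF finC] B C by blast
    qed
    then have "packing s D (Suc (Suc N'))"
      by (rule packing_insert_part) (use B C in auto)
    with maximal[of "Suc (Suc N')"] Suc show False by simp
  qed
  then have minC: "minimal_balanced s C" using C by (simp add: minimal_balanced_def)
  have twoC: "\<And>e. e \<in> C \<Longrightarrow> card e = 2" and signC: "\<And>e. e \<in> C \<Longrightarrow> s e = 1 \<or> s e = -1"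
    using C(2) two sign by blast+
  obtain a r where r: "r \<in> C" "a \<in> r" "s r = 1"
    and unique: "\<And>e. e \<in> C \<Longrightarrow> a \<in> e \<Longrightarrow> s e = 1 \<Longrightarrow> e = r"
    using exists_unique_positive_edge[OF minC finC twoC signC] by metis
  obtain x L where trail: "alternating_trail s C x L" and x: "x 0 = a" "0 < L" "even L" "x L = a"
    using exists_closed_alternating_trail[OF finC C(3) twoC signC r] by metis
  let ?e = "\<lambda>i. {x i, x (Suc i)}"
  have inj: "?e i = ?e j \<Longrightarrow> i = j" if "i < L" "j < L" for i j
    using trail that unfolding alternating_trail_def by (auto dest: inj_onD)
  have "L \<noteq> 2"
    using inj[of 0 1] x by (auto simp: numeral_2_eq_2 insert_commute)
  then have "4 \<le> L" using x(2,3) by presburger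
  define b c d where bcd: "b = x 1" "c = x 2" "d = x 3"
  have e: "?e 0 = {a, b}" "?e 1 = {b, c}" "?e 2 = {c, d}"
    using x(1) by (simp_all add: bcd numeral_2_eq_2 numeral_3_eq_3)
  have in_trail: "?e i \<in> C \<and> s (?e i) = (-1) ^ i" if "i < 4" for i
    using trail \<open>4 \<le> L\<close> that unfolding alternating_trail_def by simp
  have inC: "{a, b} \<in> C" "{b, c} \<in> C" "{c, d} \<in> C"
    and s: "s {a, b} = 1" "s {b, c} = -1" "s {c, d} = 1"
    using in_trail[of 0] in_trail[of 1] in_trail[of 2] unfolding e by simp_all
  have ne: "{a, b} \<noteq> {c, d}"
    using inj[of 0 2] \<open>4 \<le> L\<close> unfolding e by auto
  have "a \<noteq> b" "b \<noteq> c" "c \<noteq> d" using inC twoC card_two_doubleton_iff by metis+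
  moreover have "a \<noteq> c" "b \<noteq> d" using s by (auto simp: insert_commute)
  \<comment> \<open>Otherwise \<open>{c, d}\<close> would be a second positive edge of
    \<open>C\<close> at \<open>a\<close>.\<close>
  moreover have "a \<noteq> d"
    using unique[OF inC(1)] unique[OF inC(3)] s ne by auto
  ultimately have dist: "distinct [a, b, c, d]" by auto
  let ?T = "{{a, b}, {b, c}, {c, d}}" and ?f = "{a, d}"
  have f_notin: "?f \<notin> ?T" using dist by (auto simp: doubleton_eq_iff)
  \<comment> \<open>The signs cancel at \<open>b\<close> and \<open>c\<close>, so \<open>?T\<close>
    acts like a single positive edge \<open>?f\<close>: the two can replace each other, and a
    negative \<open>?f\<close> balances \<open>?T\<close>.\<close>
  have degT: "signed_degree s ?T v = of_bool (v \<in> ?f)" for v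
  proof -
    have "signed_degree s ?T v =
        of_bool (v \<in> {a, b}) * s {a, b} + of_bool (v \<in> {b, c}) * s {b, c} +
        of_bool (v \<in> {c, d}) * s {c, d}"
      using dist unfolding signed_degree_def
      by (simp add: doubleton_eq_iff del: sum_of_bool_mult_eq sum_mult_of_bool_eq)
    with dist s show ?thesis by auto
  qed
  have T: "?T \<subseteq> C" using inC by simp
  have "card ?T = 3" using dist by (auto simp: doubleton_eq_iff)
  have CT: "C - ?T \<noteq> {}"
  proof
    assume "C - ?T = {}"
    then have "C = ?T" using T by blast
    then have "signed_degree s ?T a = 0" using C(3) by (simp add: balanced_def)
    then show False by (simp add: degT)
  qed
  have shortcut: "balanced s' (insert ?f (C - ?T))"
    if "?f \<notin> C" "s' ?f = 1" "\<forall>e\<in>D. s' e = s e" for s'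
  proof -
    have eq: "signed_degree s' B v = signed_degree s B v" if "B \<subseteq> C" for B v
      using that C(2) \<open>\<forall>e\<in>D. s' e = s e\<close> by (intro signed_degree_cong) auto
    have "signed_degree s' ({?f} \<union> (C - ?T)) v = 0" for v
      using that(1,2) finC T C(3)
      by (subst signed_degree_Un) (auto simp: eq signed_degree_Diff degT balanced_def
          signed_degree_def[of _ "{?f}"])
    then show ?thesis by (simp add: balanced_def)
  qed
  consider "?f \<in> D" "s ?f = -1" | "?f \<in> D" "s ?f = 1" | "?f \<notin> D" using sign by blast
  then show thesis
  proof cases
    case 1
    let ?Q = "{{a, b}, {b, c}, {c, d}, {a, d}}"
    have Q: "?Q = ?T \<union> {?f}" by auto
    have "signed_degree s ?Q v = 0" for v
      unfolding Q using f_notin 1(2)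
      by (subst signed_degree_Un) (auto simp: degT signed_degree_def[of _ "{?f}"])
    then have balQ: "balanced s ?Q" by (simp add: balanced_def)
    \<comment> \<open>If the chord lies in \<open>C\<close>, then \<open>?Q\<close> is
      \<open>C\<close> itself. Otherwise it lies in another part \<open>B\<close>, and
      \<open>C\<close> and \<open>B\<close> are exchanged for \<open>?Q\<close> and the rest of
      their union.\<close>
    have "packing s (D - ?Q) N'"
    proof (cases "?f \<in> C")
      case True
      then have "?Q = C"
        using minC balQ T unfolding minimal_balanced_def by (metis Q Un_subset_iff bot.extremum insert_subset insert_not_empty)
      with C(4) show ?thesis by simp
    next
      case False
      with 1(1) have "?f \<in> D - C" by simp
      with C(4) obtain B c' where B: "?f \<in> B" "B \<subseteq> D - C" "balanced s B"
        "packing s ((D - C) - B) c'" "N' = Suc c'" by (rule packing_part)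
      have finB: "finite B" using B(2) assms(1) finite_subset by blast
      let ?R = "(C \<union> B) - ?Q"
      have Qsub: "?Q \<subseteq> C \<union> B" using T B(1) by blast
      have "balanced s (C \<union> B)"
        using finC finB B C(3) by (intro balanced_Un) auto
      then have "balanced s ?R"
        using finC finB Qsub balQ by (intro balanced_Diff) auto
      moreover have "?R \<noteq> {}" using CT False by blast
      moreover have "(D - ?Q) - ?R = (D - C) - B" using Qsub by blast
      then have "packing s ((D - ?Q) - ?R) c'" using B(4) by simp
      moreover have "?R \<subseteq> D - ?Q" using B(2) C(2) by blast
      ultimately show ?thesis
        unfolding B(5) by (intro packing_insert_part[of s "D - ?Q" ?R])
    qed
    with 1 Suc show thesis
      by (intro that[OF maximal[OF assms(5)] dist _ _ _ s]) (use inC C(2) in auto)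
  next
    case 2
    have "?f \<notin> C"
    proof
      assume "?f \<in> C"
      then have "?f = {a, b}" using unique[of ?f] unique[OF inC(1)] 2(2) s(1) by simp
      then show False using dist by (simp add: doubleton_eq_iff)
    qed
    with 2(1) have "?f \<in> D - C" by simp
    with C(4) obtain B c' where B: "?f \<in> B" "B \<subseteq> D - C" "balanced s B"
      "packing s ((D - C) - B) c'" "N' = Suc c'" by (rule packing_part)
    have finB: "finite B" using B(2) assms(1) finite_subset by blast
    \<comment> \<open>Exchanging \<open>?T\<close> and the chord between the parts \<open>C\<close>
      and \<open>B\<close> keeps the number of parts, but \<open>?C\<close> has two edges fewer than
      \<open>C\<close>, against the choice of \<open>C\<close>.\<close>
    let ?C = "insert ?f (C - ?T)" and ?R = "(B - {?f}) \<union> ?T"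
    have balC: "balanced s ?C" using shortcut \<open>?f \<notin> C\<close> 2(2) by simp
    have disj: "(B - {?f}) \<inter> ?T = {}" using B(2) T by blast
    have "signed_degree s ?R v = 0" for v
      using finB B(1,3) 2(2)
      by (subst signed_degree_Un[OF _ _ disj]) (simp_all add: signed_degree_Diff degT balanced_def
          signed_degree_def[of _ "{?f}"])
    then have "balanced s ?R" by (simp add: balanced_def)
    moreover have "(D - ?C) - ?R = (D - C) - B" using B T f_notin by blast
    then have "packing s ((D - ?C) - ?R) c'" using B(4) by simp
    moreover have "?R \<subseteq> D - ?C" using B(2) C(2) T f_notin by blast
    moreover have "?R \<noteq> {}" by simp
    ultimately have "packing s (D - ?C) N'"
      unfolding B(5) by (intro packing_insert_part[of s "D - ?C" ?R])
    then have "card C \<le> card ?C" using least[of ?C] balC 2(1) C(2) by blast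
    moreover have "card ?C = card C - 3 + 1"
      using finC \<open>?f \<notin> C\<close> \<open>card ?T = 3\<close> T by (simp add: card_Diff_subset)
    moreover have "3 \<le> card C" using card_mono[OF finC T] \<open>card ?T = 3\<close> by simp
    ultimately show thesis by simp
  next
    case 3
    \<comment> \<open>The new edge has to be positive, but its original sign is left open, so the
      result serves for a swap in either graph.\<close>
    have "packing s' (insert ?f (D - ?T)) N" if s': "\<forall>e\<in>D. s' e = s e" "s' ?f = 1" for s'
    proof -
      have "packing s' (D - C) N'" using packing_cong[OF C(4)] s'(1) by simp
      moreover have "insert ?f (D - ?T) - insert ?f (C - ?T) = D - C" using 3 T by blast
      moreover have "balanced s' (insert ?f (C - ?T))" using shortcut s' 3 C(2) by blast
      moreover have "insert ?f (C - ?T) \<subseteq> insert ?f (D - ?T)" using C(2) by blast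
      ultimately show ?thesis
        using packing_insert_part[of s' "insert ?f (D - ?T)" "insert ?f (C - ?T)" N'] Suc by simp
    qed
    with 3 show thesis
      by (intro that[OF maximal[OF assms(5)] dist _ _ _ s]) (use inC C(2) in auto)
  qed
qed

text \<open>Minimal balanced sets are split off one by one; each has fewer than
  \<open>3 * card V / 2\<close> edges, which bounds their number from below.\<close>

lemma exists_packing:
  assumes "finite D" "balanced s D" "finite V"
    "\<And>e. e \<in> D \<Longrightarrow> e \<subseteq> V \<and> card e = 2"
    "\<And>e. e \<in> D \<Longrightarrow> s e = 1 \<or> s e = -1"
  shows "\<exists>c. packing s D c \<and> 2 * card D \<le> 3 * card V * c"
  using assms
proof (induction D rule: finite_psubset_induct)
  case (psubset D)
  show ?case
  proof (cases "D = {}")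
    case True
    then show ?thesis using packing.empty by auto
  next
    case False
    then obtain C where C: "C \<subseteq> D" "minimal_balanced s C"
      using exists_minimal_balanced_subset psubset.hyps psubset.prems(1) by blast
    then have bal: "balanced s C" "C \<noteq> {}" by (simp_all add: minimal_balanced_def)
    have finC: "finite C" using C(1) psubset.hyps finite_subset by blast
    have "2 * card C + 3 \<le> 3 * card (\<Union>C)"
      by (rule minimal_balanced_card_bound[OF C(2) finC]) (use C(1) psubset.prems in blast)+
    moreover have "card (\<Union>C) \<le> card V"
      using C(1) psubset.prems(2,3) by (intro card_mono) blast+
    ultimately have small: "2 * card C \<le> 3 * card V" by simp
    have "\<exists>c. packing s (D - C) c \<and> 2 * card (D - C) \<le> 3 * card V * c"
    proof (rule psubset.IH)
      show "D - C \<subset> D" using C(1) bal(2) by blast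
      show "balanced s (D - C)"
        using balanced_Diff psubset.hyps C(1) psubset.prems(1) bal(1) by blast
    qed (use psubset.prems in auto)
    then obtain c where c: "packing s (D - C) c" "2 * card (D - C) \<le> 3 * card V * c" by blast
    have "packing s D (Suc c)" using packing_insert_part[OF c(1) C(1) bal] .
    moreover have "card D = card C + card (D - C)"
      using card_Diff_subset[OF finC C(1)] card_mono[OF psubset.hyps C(1)] by simp
    ultimately show ?thesis using c(2) small by (intro exI[of _ "Suc c"]) simp
  qed
qed

section \<open>Swaps\<close>

text \<open>The vertices are listed along a 4-cycle, whose first and third edges are exchanged for
  the second and fourth.\<close>

lemma swapI:
  assumes "distinct [a, b, c, d]" "{a, b} \<in> G" "{c, d} \<in> G" "{b, c} \<notin> G" "{a, d} \<notin> G"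
  shows "swap G (G - {{a, b}, {c, d}} \<union> {{b, c}, {a, d}})"
  unfolding swap_def using assms
  by (intro exI[of _ a] exI[of _ c] exI[of _ b] exI[of _ d]) (auto simp: insert_commute)

text \<open>Allows swaps made in the target graph to be traversed backwards.\<close>

lemma swap_sym:
  assumes "swap G H"
  shows "swap H G"
proof -
  obtain a b c d where abcd: "distinct [a, b, c, d]"
    "{a, c} \<in> G" "{b, d} \<in> G" "{b, c} \<notin> G" "{a, d} \<notin> G"
    and H: "H = G - {{a, c}, {b, d}} \<union> {{b, c}, {a, d}}"
    using assms unfolding swap_def by blast
  have "{a, c} \<notin> H" "{b, d} \<notin> H" "{b, c} \<in> H" "{a, d} \<in> H"
    using abcd(1) by (auto simp: H doubleton_eq_iff)
  moreover have "G = H - {{b, c}, {a, d}} \<union> {{a, c}, {b, d}}"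
    using abcd unfolding H by blast
  ultimately show ?thesis
    unfolding swap_def using abcd(1)
    by (intro exI[of _ b] exI[of _ a] exI[of _ c] exI[of _ d]) auto
qed

text \<open>Edges common to both graphs also get the sign \<open>1\<close>, which is the sign they
  need when a swap removes them from the second graph.\<close>

definition edge_sign :: "'a set set \<Rightarrow> 'a set \<Rightarrow> int" where
  "edge_sign G e = (if e \<in> G then 1 else -1)"

text \<open>If \<open>f\<close> is in both graphs, the swap in \<open>G\<close> is blocked and the
  reverse exchange is made in \<open>H\<close> instead.\<close>

lemma sym_diff_exchange:
  assumes "p \<in> G" "r \<in> G" "q \<notin> G" "p \<notin> H" "r \<notin> H" "q \<in> H"
  shows "f \<notin> G \<Longrightarrow> f \<in> H \<Longrightarrow>
      sym_diff (G - {p, r} \<union> {q, f}) H = sym_diff G H - {p, q, r, f}"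
    and "f \<notin> G \<Longrightarrow> f \<notin> H \<Longrightarrow>
      sym_diff (G - {p, r} \<union> {q, f}) H = insert f (sym_diff G H - {p, q, r})"
    and "f \<in> G \<Longrightarrow> f \<in> H \<Longrightarrow>
      sym_diff G (H - {q, f} \<union> {r, p}) = insert f (sym_diff G H - {p, q, r})"
  using assms by auto

lemma edge_sign_exchange:
  assumes "e \<in> insert f (sym_diff G H - {p, q, r})"
  shows "((edge_sign G)(f := 1)) e = edge_sign (G - {p, r} \<union> {q, f}) e"
  using assms by (auto simp: edge_sign_def)

text \<open>Each swap either removes four edges at the cost of one part, or replaces three edges by
  one and keeps the number of parts. Both lower \<open>card (sym_diff G1 G2) - 2 * c\<close> by
  \<open>2\<close>, and passing to a larger packing only helps.\<close>

theorem packing_swaps: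
  assumes "finite (sym_diff G1 G2)" "\<And>e. e \<in> sym_diff G1 G2 \<Longrightarrow> card e = 2"
    "packing (edge_sign G1) (sym_diff G1 G2) c"
  shows "\<exists>k. (swap ^^ k) G1 G2 \<and> 2 * k + 2 * c \<le> card (sym_diff G1 G2)"
  using assms
proof (induction "card (sym_diff G1 G2)" arbitrary: G1 G2 c rule: less_induct)
  case less
  let ?D = "sym_diff G1 G2" and ?s = "edge_sign G1"
  show ?case
  proof (cases "?D = {}")
    case True
    then have "G1 = G2" by blast
    then have "(swap ^^ 0) G1 G2" by simp
    moreover have "c = 0" using packing_le_card[OF less.prems(3,1)] True by simp
    ultimately show ?thesis by fastforce
  next
    case False
    obtain a b u d N where "c \<le> N" and dist: "distinct [a, b, u, d]"
      and D: "{a, b} \<in> ?D" "{b, u} \<in> ?D" "{u, d} \<in> ?D"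
      and s: "?s {a, b} = 1" "?s {b, u} = -1" "?s {u, d} = 1"
      and alt: "({a, d} \<in> ?D \<and> ?s {a, d} = -1 \<and>
          (\<exists>N'. N = Suc N' \<and> packing ?s (?D - {{a, b}, {b, u}, {u, d}, {a, d}}) N'))
        \<or> ({a, d} \<notin> ?D \<and> (\<forall>s'. (\<forall>e\<in>?D. s' e = ?s e) \<longrightarrow> s' {a, d} = 1 \<longrightarrow>
          packing s' (insert {a, d} (?D - {{a, b}, {b, u}, {u, d}})) N))"
      by (rule packing_reduction[OF less.prems(1) False less.prems(2) _ less.prems(3)])
        (auto simp: edge_sign_def)
    have mem: "{a, b} \<in> G1" "{u, d} \<in> G1" "{b, u} \<notin> G1"
      "{a, b} \<notin> G2" "{u, d} \<notin> G2" "{b, u} \<in> G2"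
      using D s by (auto simp: edge_sign_def split: if_splits)
    have ne: "{a, b} \<noteq> {u, d}" "{a, b} \<noteq> {a, d}" "{b, u} \<noteq> {a, d}" "{u, d} \<noteq> {a, d}"
      "{a, b} \<noteq> {b, u}" "{u, d} \<noteq> {b, u}"
      using dist by (auto simp: doubleton_eq_iff)
    have "card {a, d} = 2" using dist by simp
    let ?T = "{{a, b}, {b, u}, {u, d}}"
    let ?Q = "{{a, b}, {b, u}, {u, d}, {a, d}}"
    have cardT: "card ?T = 3" using ne by simp
    have cardDT: "card (?D - ?T) + 3 = card ?D"
      using card_Diff_subset[of ?T ?D] card_mono[OF less.prems(1), of ?T] D cardT by simp
    define H where "H = G1 - {{a, b}, {u, d}} \<union> {{b, u}, {a, d}}"
    have swapH: "swap G1 H" if "{a, d} \<notin> G1"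
      unfolding H_def using swapI[OF dist] mem that by simp
    have extend: "\<exists>k. (swap ^^ k) G1 G2 \<and> 2 * k + 2 * c \<le> card ?D"
      if "(swap ^^ k) H G2" "{a, d} \<notin> G1" "2 * Suc k + 2 * N \<le> card ?D" for k
    proof -
      have "(swap ^^ Suc k) G1 G2" using relpowp_Suc_I2[OF swapH[OF that(2)] that(1)] .
      with that(3) \<open>c \<le> N\<close> show ?thesis by (intro exI[of _ "Suc k"]) simp
    qed
    have pack: "packing s' (insert {a, d} (?D - ?T)) N"
      if "{a, d} \<notin> ?D" "\<forall>e\<in>?D. s' e = ?s e" "s' {a, d} = 1" for s'
      using alt that by blast
    consider (chord) "{a, d} \<in> ?D" | (new) "{a, d} \<notin> ?D" "{a, d} \<notin> G1"
      | (common) "{a, d} \<notin> ?D" "{a, d} \<in> G1" by blast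
    then show ?thesis
    proof cases
      case chord
      with alt obtain N' where N': "N = Suc N'" "packing ?s (?D - ?Q) N'"
        and "?s {a, d} = -1" by blast
      then have f: "{a, d} \<notin> G1" "{a, d} \<in> G2"
        using chord by (auto simp: edge_sign_def split: if_splits)
      have D': "sym_diff H G2 = ?D - ?Q"
        unfolding H_def using sym_diff_exchange(1)[OF mem f] .
      have card: "card (sym_diff H G2) + 4 = card ?D"
        unfolding D' using card_Diff_subset[of ?Q ?D] card_mono[OF less.prems(1), of ?Q] D chord ne
        by simp
      have "\<exists>k. (swap ^^ k) H G2 \<and> 2 * k + 2 * N' \<le> card (sym_diff H G2)"
      proof (rule less.hyps)
        show "packing (edge_sign H) (sym_diff H G2) N'"
          unfolding D' using N'(2) by (rule packing_cong) (auto simp: edge_sign_def H_def)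
      qed (use card D' less.prems(1,2) in auto)
      then show ?thesis using extend f(1) card N'(1) by fastforce
    next
      case new
      then have f: "{a, d} \<notin> G2" by blast
      have D': "sym_diff H G2 = insert {a, d} (?D - ?T)"
        unfolding H_def using sym_diff_exchange(2)[OF mem new(2) f] .
      have card: "card (sym_diff H G2) + 2 = card ?D"
        using cardDT D' less.prems(1) new(1) by simp
      have "\<exists>k. (swap ^^ k) H G2 \<and> 2 * k + 2 * N \<le> card (sym_diff H G2)"
      proof (rule less.hyps)
        have "packing (?s({a, d} := 1)) (sym_diff H G2) N"
          unfolding D' using pack[OF new(1)] new(1) by (metis fun_upd_apply)
        then show "packing (edge_sign H) (sym_diff H G2) N"
        proof (rule packing_cong)
          fix e assume "e \<in> sym_diff H G2"
          then show "(?s({a, d} := 1)) e = edge_sign H e"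
            unfolding D' unfolding H_def by (rule edge_sign_exchange)
        qed
        show "card (sym_diff H G2) < card ?D" using card by simp
        show "finite (sym_diff H G2)" unfolding D' using less.prems(1) by simp
        show "card e = 2" if "e \<in> sym_diff H G2" for e
          using that less.prems(2) \<open>card {a, d} = 2\<close> unfolding D' by blast
      qed
      then show ?thesis using extend new(2) card by fastforce
    next
      \<comment> \<open>As \<open>{a, d}\<close> is already present in \<open>G1\<close>, the swap
        is made in \<open>G2\<close>; its reverse becomes the last step of the sequence.\<close>
      case common
      have f: "{a, d} \<in> G2" using common by blast
      define K where "K = G2 - {{b, u}, {a, d}} \<union> {{u, d}, {a, b}}"
      have dist': "distinct [b, u, d, a]" using dist by auto
      have "swap G2 K"
        unfolding K_def using swapI[OF dist', of G2] mem f
        unfolding insert_commute[of d a "{}"] insert_commute[of b a "{}"] by simp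
      then have "swap K G2" by (rule swap_sym)
      have D': "sym_diff G1 K = insert {a, d} (?D - ?T)"
        unfolding K_def using sym_diff_exchange(3)[OF mem common(2) f] .
      have card: "card (sym_diff G1 K) + 2 = card ?D"
        using cardDT D' less.prems(1) common(1) by simp
      have "\<exists>k. (swap ^^ k) G1 K \<and> 2 * k + 2 * N \<le> card (sym_diff G1 K)"
      proof (rule less.hyps)
        show "packing ?s (sym_diff G1 K) N"
          unfolding D' using common by (intro pack) (simp_all add: edge_sign_def)
        show "card (sym_diff G1 K) < card ?D" using card by simp
        show "finite (sym_diff G1 K)" unfolding D' using less.prems(1) by simp
        show "card e = 2" if "e \<in> sym_diff G1 K" for e
          using that less.prems(2) \<open>card {a, d} = 2\<close> unfolding D' by blast
      qed
      then obtain k where k: "(swap ^^ k) G1 K" "2 * k + 2 * N \<le> card (sym_diff G1 K)" by blast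
      have "(swap ^^ Suc k) G1 G2" using relpowp_Suc_I[OF k(1) \<open>swap K G2\<close>] .
      with k(2) card \<open>c \<le> N\<close> show ?thesis by (intro exI[of _ "Suc k"]) simp
    qed
  qed
qed

section \<open>Realizations\<close>

lemma degree_Un_disjoint:
  assumes "finite A" "finite B" "A \<inter> B = {}"
  shows "degree (A \<union> B) v = degree A v + degree B v"
proof -
  have "{e \<in> A \<union> B. v \<in> e} = {e \<in> A. v \<in> e} \<union> {e \<in> B. v \<in> e}" by blast
  then show ?thesis
    unfolding degree_def using assms by (simp add: card_Un_disjoint disjoint_iff)
qed

lemma degree_Diff_add_Int:
  assumes "finite A"
  shows "degree (A - B) v + degree (A \<inter> B) v = degree A v"
  using degree_Un_disjoint[of "A - B" "A \<inter> B" v] assms by (simp add: Un_Diff_Int Int_Diff_disjoint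
    Diff_Int_distrib2 inf_commute)

lemma degree_less_card:
  assumes "simple_graph V E" "v \<in> V"
  shows "degree E v < card V"
proof -
  have fin: "finite V" using assms(1) by (simp add: simple_graph_def)
  have "{e \<in> E. v \<in> e} \<subseteq> (\<lambda>u. {v, u}) ` (V - {v})"
  proof
    fix e assume "e \<in> {e \<in> E. v \<in> e}"
    then have "e \<subseteq> V" "card e = 2" "v \<in> e" using assms(1) by (auto simp: simple_graph_def)
    then obtain u where "e = {v, u}" "u \<noteq> v" by (metis card_2_iff insert_commute insertE singletonD)
    with \<open>e \<subseteq> V\<close> show "e \<in> (\<lambda>u. {v, u}) ` (V - {v})" by blast
  qed
  then have "degree E v \<le> card (V - {v})"
    unfolding degree_def using fin by (intro surj_card_le) auto
  also have "\<dots> < card V" using card_Diff1_less[OF fin assms(2)] .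
  finally show ?thesis .
qed

text \<open>Common edges contribute equally to both degrees and cancel.\<close>

lemma signed_degree_sym_diff:
  assumes "finite G1" "finite G2"
  shows "signed_degree (edge_sign G1) (sym_diff G1 G2) v = int (degree G1 v) - int (degree G2 v)"
proof -
  have deg: "(\<Sum>e\<in>A. of_bool (v \<in> e)) = int (degree A v)" if "finite A" for A
    using that by (simp add: degree_def Int_def)
  have "signed_degree (edge_sign G1) (G1 - G2) v = (\<Sum>e\<in>G1 - G2. of_bool (v \<in> e))"
    unfolding signed_degree_def by (rule sum.cong) (auto simp: edge_sign_def)
  moreover have "signed_degree (edge_sign G1) (G2 - G1) v = (\<Sum>e\<in>G2 - G1. - of_bool (v \<in> e))"
    unfolding signed_degree_def by (rule sum.cong) (auto simp: edge_sign_def)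
  ultimately have "signed_degree (edge_sign G1) (sym_diff G1 G2) v =
      int (degree (G1 - G2) v) - int (degree (G2 - G1) v)"
    using assms deg by (subst signed_degree_Un) (auto simp: sum_negf simp del: sum_of_bool_eq)
  then show ?thesis
    using degree_Diff_add_Int[OF assms(1), of G2 v] degree_Diff_add_Int[OF assms(2), of G1 v]
    by (simp add: Int_commute)
qed

text \<open>Each difference contributes at most \<open>k\<close> edges at \<open>v\<close>; and
  since the union has fewer than \<open>card V\<close> edges at \<open>v\<close>, of which
  \<open>k\<close> belong to the other graph, also at most \<open>card V - k\<close>.\<close>

lemma degree_sym_diff_le:
  assumes "simple_graph V G1" "simple_graph V G2" "v \<in> V" "degree G1 v = k" "degree G2 v = k"
  shows "degree (sym_diff G1 G2) v \<le> 2 * min k (card V - k)"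
proof -
  have fin: "finite G1" "finite G2" using assms(1,2) finite_simple_graph by blast+
  have "simple_graph V (G1 \<union> G2)" using assms(1,2) by (auto simp: simple_graph_def)
  then have "degree (G1 \<union> G2) v < card V" using assms(3) by (rule degree_less_card)
  moreover have "degree (G1 \<union> G2) v = degree (G1 - G2) v + degree G2 v"
    "degree (G1 \<union> G2) v = degree (G2 - G1) v + degree G1 v"
    using fin degree_Un_disjoint[of "G1 - G2" G2 v] degree_Un_disjoint[of "G2 - G1" G1 v]
    by (auto simp: Un_commute)
  moreover have "degree (G1 - G2) v \<le> degree G1 v" "degree (G2 - G1) v \<le> degree G2 v"
    using degree_Diff_add_Int[OF fin(1), of G2 v] degree_Diff_add_Int[OF fin(2), of G1 v] by simp_all
  moreover have "degree (sym_diff G1 G2) v = degree (G1 - G2) v + degree (G2 - G1) v"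
    using fin by (intro degree_Un_disjoint) auto
  ultimately show ?thesis using assms(4,5) by linarith
qed

theorem theorem3p8:
  fixes ds :: "nat list" and n :: nat and m mstar :: real and G1 G2 :: "nat set set"
  assumes "degree_sequence ds"
    and "n = length ds"
    and "m = (\<Sum>i<n. real (ds ! i)) / 2"
    and "mstar = (\<Sum>i<n. min (real (ds ! i)) (real n - real (ds ! i)))"
    and "realizes G1 ds"
    and "realizes G2 ds"
  shows "ereal_of_enat (swap_dist G1 G2) \<le> ereal (half_sym_diff G1 G2 * (1 - 4 / (3 * real n)))
    \<and> half_sym_diff G1 G2 * (1 - 4 / (3 * real n)) \<le> mstar * (1 / 2 - 2 / (3 * real n))
    \<and> mstar * (1 / 2 - 2 / (3 * real n)) \<le> m * (1 - 4 / (3 * real n))"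
proof -
  let ?D = "sym_diff G1 G2" and ?V = "{..<n}"
  have G: "simple_graph ?V G1" "simple_graph ?V G2"
    and deg: "\<And>i. i < n \<Longrightarrow> degree G1 i = ds ! i" "\<And>i. i < n \<Longrightarrow> degree G2 i = ds ! i"
    using assms by (simp_all add: realizes_def)
  have fin: "finite G1" "finite G2" using G finite_simple_graph by blast+
  have D: "simple_graph ?V ?D" using G by (auto simp: simple_graph_def)
  have lt: "ds ! i < n" if "i < n" for i
    using degree_less_card[OF G(1), of i] deg(1) that by simp
  \<comment> \<open>A single vertex cannot have positive degree. This excludes the only
    \<open>n\<close> for which the factor \<open>1 - 4 / (3 * n)\<close> is negative.\<close>
  have "n \<noteq> 1"
    using lt[of 0] assms(1,2) by (auto simp: degree_sequence_def length_Suc_conv)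
  \<comment> \<open>Balance is required at every natural number, also outside the vertex
    set.\<close>
  have "degree G1 v = degree G2 v" for v
  proof (cases "v < n")
    case False
    then have "degree G v = 0" if "simple_graph ?V G" for G
    proof -
      have "{e \<in> G. v \<in> e} = {}" using that False by (auto simp: simple_graph_def)
      then show ?thesis by (simp only: degree_def card.empty)
    qed
    then show ?thesis using G by simp
  qed (simp add: deg)
  then have "balanced (edge_sign G1) ?D"
    by (simp add: balanced_def signed_degree_sym_diff[OF fin])
  moreover have "edge_sign G1 e = 1 \<or> edge_sign G1 e = -1" for e by (simp add: edge_sign_def)
  ultimately obtain c where c: "packing (edge_sign G1) ?D c" "2 * card ?D \<le> 3 * card ?V * c"
    using exists_packing[of ?D "edge_sign G1" ?V] D fin
    by (auto simp: simple_graph_def)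
  obtain k where k: "(swap ^^ k) G1 G2" "2 * k + 2 * c \<le> card ?D"
    using packing_swaps[OF finite_simple_graph[OF D] _ c(1)] D unfolding simple_graph_def by blast
  have "real (2 * card ?D) \<le> real (3 * n * c)"
    using c(2) unfolding of_nat_le_iff by simp
  then have "2 * real (card ?D) \<le> 3 * real n * real c" by simp
  \<comment> \<open>This is the bound \<open>4 H' / (3 n)\<close> on the number of parts; for
    \<open>n = 0\<close> the quotient is \<open>0\<close>.\<close>
  then have "2 * real (card ?D) / (3 * real n) \<le> c"
    by (cases "n = 0") (simp_all add: field_simps)
  moreover have "real (2 * k + 2 * c) \<le> real (card ?D)" using k(2) by (rule of_nat_mono)
  ultimately have "real k \<le> half_sym_diff G1 G2 * (1 - 4 / (3 * real n))"
    by (simp add: half_sym_diff_def field_simps)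
  moreover have "swap_dist G1 G2 \<le> enat k"
    unfolding swap_dist_def using k(1) by (intro Inf_lower) blast
  then have "ereal_of_enat (swap_dist G1 G2) \<le> ereal (real k)"
    by (metis ereal_of_enat_le_iff ereal_of_enat_simps(1))
  ultimately have dist: "ereal_of_enat (swap_dist G1 G2)
      \<le> ereal (half_sym_diff G1 G2 * (1 - 4 / (3 * real n)))"
    using order_trans ereal_less_eq(3) by blast
  have "2 * card ?D = (\<Sum>v<n. degree ?D v)" using sum_degree_eq[OF D] by simp
  also have "\<dots> \<le> (\<Sum>v<n. 2 * min (ds ! v) (n - ds ! v))"
    using degree_sym_diff_le[OF G] deg by (intro sum_mono) simp
  finally have "real (2 * card ?D) \<le> real (\<Sum>v<n. 2 * min (ds ! v) (n - ds ! v))"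
    by (rule of_nat_mono)
  \<comment> \<open>The truncated difference \<open>n - ds ! v\<close> agrees with the real one,
    because degrees are less than \<open>n\<close>.\<close>
  also have "\<dots> = 2 * mstar"
    unfolding assms(4) sum_distrib_left of_nat_sum
    by (rule sum.cong) (simp_all add: of_nat_min of_nat_diff less_imp_le lt)
  finally have D_le: "half_sym_diff G1 G2 \<le> mstar / 2" by (simp add: half_sym_diff_def)
  have mstar_le: "mstar / 2 \<le> m" unfolding assms(3,4) by (simp add: divide_right_mono sum_mono)
  have half: "x / 2 * (1 - 4 / (3 * real n)) = x * (1 / 2 - 2 / (3 * real n))" for x
    by (simp add: algebra_simps)
  \<comment> \<open>For \<open>n = 0\<close> division by zero makes the factor
    \<open>1\<close>.\<close>
  have nonneg: "0 \<le> 1 - 4 / (3 * real n)"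
    using \<open>n \<noteq> 1\<close> by (cases "n = 0") (simp_all add: field_simps)
  then show ?thesis
    using dist mult_right_mono[OF D_le nonneg] mult_right_mono[OF mstar_le nonneg]
    unfolding half by blast
qed

end
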